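(* For all $n$, \[\mathrm{ex}_o(n,R_3) = \left\lfloor \frac{n}{2} \right\rfloor \left\lceil \frac{n}{2} \right\rceil \frac{n-2}{2}.\] Moreover, for each $n$ there is exactly one $R_3$-free oriented graph on $n$ vertices with this many edges, up to isomorphism.
   Context: A $2\to1$ directed hypergraph (here simply a "graph") is a pair $H=(V,E)$ with $V$ a finite vertex set and $E$ a set of edges, each edge being a 3-element subset $\{a,b,c\}$ of $V$ with one element marked as the head; the edge with underlying set $\{a,b,c\}$ and head $c$ is written $ab \to c$. $H$ is oriented if every 3-subset of $V$ carries at most one edge. A homomorphism $\phi:F\to G$ is a map $V(F)\to V(G)$ with $ab\to c\in E(F)\Rightarrow \phi(a)\phi(b)\to\phi(c)\in E(G)$. $G$ is $F$-free if there is no injective homomorphism $F\to G$. $\mathrm{ex}_o(n,F)$ is the maximum number of edges of an $F$-free oriented graph on $n$ vertices. $R_3$ is the graph with vertex set $\{a,b,c,d\}$ and edge set $\{ab\to c,\ bc\to d\}$. *)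

theory Defs
  imports Complex_Main
begin

text \<open>
  An edge is a pair \<open>(S, c)\<close> of its underlying 3-element set \<open>S\<close> and its head \<open>c \<in> S\<close>.
\<close>

record 'a dhgraph =
  verts :: "'a set"
  edges :: "('a set \<times> 'a) set"

definition arrow :: "'a \<Rightarrow> 'a \<Rightarrow> 'a \<Rightarrow> 'a set \<times> 'a" where
  "arrow a b c = ({a, b, c}, c)"

definition dhgraph :: "'a dhgraph \<Rightarrow> bool" where
  "dhgraph H \<longleftrightarrow> finite (verts H) \<and>
     (\<forall>(S, c) \<in> edges H. S \<subseteq> verts H \<and> card S = 3 \<and> c \<in> S)"

definition oriented :: "'a dhgraph \<Rightarrow> bool" where
  "oriented H \<longleftrightarrow> (\<forall>S c d. (S, c) \<in> edges H \<and> (S, d) \<in> edges H \<longrightarrow> c = d)"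

definition dh_hom :: "('a \<Rightarrow> 'b) \<Rightarrow> 'a dhgraph \<Rightarrow> 'b dhgraph \<Rightarrow> bool" where
  "dh_hom \<phi> F G \<longleftrightarrow> \<phi> ` verts F \<subseteq> verts G \<and>
     (\<forall>a b c. arrow a b c \<in> edges F \<longrightarrow> arrow (\<phi> a) (\<phi> b) (\<phi> c) \<in> edges G)"

definition dh_free :: "'b dhgraph \<Rightarrow> 'a dhgraph \<Rightarrow> bool" where
  "dh_free F G \<longleftrightarrow> \<not> (\<exists>\<phi>. dh_hom \<phi> F G \<and> inj_on \<phi> (verts F))"

definition dh_iso :: "'a dhgraph \<Rightarrow> 'b dhgraph \<Rightarrow> bool" where
  "dh_iso G H \<longleftrightarrow> (\<exists>\<phi>. bij_betw \<phi> (verts G) (verts H) \<and>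
     (\<forall>a \<in> verts G. \<forall>b \<in> verts G. \<forall>c \<in> verts G.
        arrow a b c \<in> edges G \<longleftrightarrow> arrow (\<phi> a) (\<phi> b) (\<phi> c) \<in> edges H))"

definition free_oriented :: "nat \<Rightarrow> 'b dhgraph \<Rightarrow> 'a dhgraph \<Rightarrow> bool" where
  "free_oriented n F G \<longleftrightarrow> dhgraph G \<and> oriented G \<and> card (verts G) = n \<and> dh_free F G"

text \<open>
  Every finite graph has an isomorphic copy with vertices in \<open>nat\<close>, so it suffices to let the
  maximum range over those.
\<close>

definition ex_o :: "nat \<Rightarrow> 'b dhgraph \<Rightarrow> nat" where
  "ex_o n F = Max {card (edges G) | G :: nat dhgraph. free_oriented n F G}"

definition R3 :: "nat dhgraph" where
  "R3 = \<lparr>verts = {0, 1, 2, 3}, edges = {arrow 0 1 2, arrow 1 2 3}\<rparr>"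

end

(*
  In an R3-free oriented graph no pair of vertices can be both the tail of one edge and a
  head-tail pair of another. Let h be the graph of the head-tail pairs: then every edge xy -> z is
  an induced cherry of h centred at z, so the task is to maximise the number of induced cherries in
  a graph on n vertices.

  Let D be the degree sum, C the sum of the squared degrees, T the number of ordered triangles,
  Q = C - T - D the number of ordered cherries, and M = floor(n/2) ceil(n/2). Counting, for every
  ordered adjacent pair, the vertices adjacent to exactly one of the two (at most n) gives
  2Q <= (n-2)D. Counting those adjacent to neither (at least 0) gives T >= 2C - nD, and
  (d - floor(n/2))(d - ceil(n/2)) >= 0, summed over all degrees d, gives C >= nD - nM; hence
  Q <= nM - D. Eliminating D yields Q <= (n-2)M. In the equality case every vertex is adjacent to
  exactly one end of every edge of h, and D = 2M, which forces h to be the balanced complete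
  bipartite graph.
*)

theory Submission
  imports Defs
begin

section \<open>Ordered cherries and the arithmetic of balanced cuts\<close>

text \<open>The centre is the third entry. The leaves are ordered, so each induced cherry occurs
  twice, just as each edge occurs twice in \<open>arrows\<close>.\<close>

definition cherries :: "'a set \<Rightarrow> ('a \<Rightarrow> 'a \<Rightarrow> bool) \<Rightarrow> ('a \<times> 'a \<times> 'a) set" where
  "cherries V h = {(x, y, z) \<in> V \<times> V \<times> V. x \<noteq> y \<and> h x z \<and> h y z \<and> \<not> h x y}"

abbreviation balanced_cut :: "nat \<Rightarrow> nat" where
  "balanced_cut n \<equiv> (n div 2) * ((n + 1) div 2)"

definition degree_sum :: "'a set \<Rightarrow> ('a \<Rightarrow> 'a \<Rightarrow> bool) \<Rightarrow> int" where
  "degree_sum V h = (\<Sum>x\<in>V. \<Sum>y\<in>V. of_bool (h x y))"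

lemma card_triples_eq_sum:
  fixes P :: "'a \<Rightarrow> 'a \<Rightarrow> 'a \<Rightarrow> bool"
  assumes "finite V"
  shows "int (card {(x, y, z) \<in> V \<times> V \<times> V. P x y z}) =
    (\<Sum>x\<in>V. \<Sum>y\<in>V. \<Sum>z\<in>V. of_bool (P x y z))"
proof -
  have "{(x, y, z) \<in> V \<times> V \<times> V. P x y z} = {t \<in> V \<times> V \<times> V. case t of (x, y, z) \<Rightarrow> P x y z}"
    by auto
  then have "int (card {(x, y, z) \<in> V \<times> V \<times> V. P x y z}) =
      (\<Sum>t\<in>V \<times> V \<times> V. of_bool (case t of (x, y, z) \<Rightarrow> P x y z))"
    using assms by (simp add: of_bool_def sum.If_cases Int_def)
  also have "\<dots> = (\<Sum>x\<in>V. \<Sum>y\<in>V. \<Sum>z\<in>V. of_bool (P x y z))"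
    by (simp add: sum.cartesian_product case_prod_unfold)
  finally show ?thesis .
qed

text \<open>The two halves k and l of n are equal or consecutive integers, so no integer lies
  strictly between them and \<open>(d - k) * (d - l)\<close> is never negative. Expand with k + l =
  n.\<close>

lemma mult_le_square_plus_balanced_cut:
  fixes d :: int
  shows "int n * d \<le> d * d + int (balanced_cut n)"
proof -
  define k where "k = int (n div 2)"
  define l where "l = int ((n + 1) div 2)"
  have n: "int n = k + l" and kl: "l = k \<or> l = k + 1"
    unfolding k_def l_def by presburger+
  have "0 \<le> (d - k) * (d - l)"
    using kl by (cases "d \<le> k") (auto intro: mult_nonpos_nonpos mult_nonneg_nonneg)
  then show ?thesis
    unfolding of_nat_mult k_def[symmetric] l_def[symmetric] n by (simp add: algebra_simps)
qed

text \<open>Sum and product determine a pair of numbers: a and b are the roots of the same monic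
  quadratic as the two halves of n.\<close>

lemma factors_of_balanced_cut:
  fixes a b :: nat
  assumes "a + b = n" and "a * b = balanced_cut n"
  shows "a = n div 2 \<or> b = n div 2"
proof -
  define k where "k = int (n div 2)"
  define l where "l = int ((n + 1) div 2)"
  have n: "int a + int b = k + l" using assms(1) unfolding k_def l_def by presburger
  have "int a * int b = k * l"
    using assms(2) unfolding k_def l_def by (metis of_nat_mult)
  moreover have b: "int b = k + l - int a" using n by simp
  ultimately have "(int a - k) * (int a - l) = 0" by (simp add: algebra_simps)
  then have "int a = k \<or> int a = l" by simp
  then have "int a = k \<or> int b = k" using b by auto
  then show ?thesis unfolding k_def by simp
qed

section \<open>Induced cherries in a finite simple graph\<close>

context
  fixes V :: "'a set" and h :: "'a \<Rightarrow> 'a \<Rightarrow> bool"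
  assumes fin: "finite V" and sym: "\<And>x y. h x y \<Longrightarrow> h y x" and irrefl: "\<And>x. \<not> h x x"
begin

text \<open>Integer indicators turn Boolean conditions on triples into polynomials. \<open>C\<close>
  counts walks x, z, y of length two including those with x = y, hence it is the sum of the squared
  degrees.\<close>

private definition a :: "'a \<Rightarrow> 'a \<Rightarrow> int" where "a x y = of_bool (h x y)"
private definition C :: int where "C = (\<Sum>x\<in>V. \<Sum>y\<in>V. \<Sum>z\<in>V. a x z * a y z)"
private definition T :: int where "T = (\<Sum>x\<in>V. \<Sum>y\<in>V. \<Sum>z\<in>V. a x z * a y z * a x y)"

private lemma a_sym: "a x y = a y x"
  unfolding a_def using sym by (intro arg_cong[of _ _ of_bool]) blast

text \<open>From all walks of length two remove those that close to a triangle and those that return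
  to their start; the latter correspond to ordered adjacent pairs.\<close>

private lemma card_cherries: "int (card (cherries V h)) = C - T - degree_sum V h"
proof -
  have "of_bool (x \<noteq> y \<and> h x z \<and> h y z \<and> \<not> h x y) =
      a x z * a y z - a x z * a y z * a x y - (if x = y then a x z else 0)" for x y z
    using irrefl by (auto simp: a_def)
  moreover have "(\<Sum>x\<in>V. \<Sum>y\<in>V. \<Sum>z\<in>V. if x = y then a x z else 0) = degree_sum V h"
  proof -
    have "(\<Sum>y\<in>V. \<Sum>z\<in>V. if x = y then a x z else 0) = (\<Sum>z\<in>V. a x z)" if "x \<in> V" for x
    proof -
      have "(\<Sum>y\<in>V. \<Sum>z\<in>V. if x = y then a x z else 0) = (\<Sum>y\<in>V. if x = y then \<Sum>z\<in>V. a x z else 0)"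
        by (rule sum.cong) auto
      then show ?thesis using fin that by simp
    qed
    then show ?thesis by (simp add: degree_sum_def a_def)
  qed
  ultimately show ?thesis
    unfolding cherries_def card_triples_eq_sum[OF fin]
    by (simp add: C_def T_def sum_subtractf)
qed

text \<open>For an ordered adjacent pair x, z, a third vertex adjacent to z or to x extends it to a
  walk of length two centred at that end.\<close>

private lemma C_perm: "(\<Sum>x\<in>V. \<Sum>z\<in>V. \<Sum>y\<in>V. a x z * a y z) = C"
    "(\<Sum>x\<in>V. \<Sum>z\<in>V. \<Sum>y\<in>V. a x z * a x y) = C"
proof -
  show "(\<Sum>x\<in>V. \<Sum>z\<in>V. \<Sum>y\<in>V. a x z * a y z) = C"
    unfolding C_def by (intro sum.cong refl sum.swap)
  have "(\<Sum>x\<in>V. \<Sum>z\<in>V. \<Sum>y\<in>V. a x z * a x y) = (\<Sum>z\<in>V. \<Sum>x\<in>V. \<Sum>y\<in>V. a x z * a x y)"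
    by (rule sum.swap)
  also have "\<dots> = (\<Sum>z\<in>V. \<Sum>y\<in>V. \<Sum>x\<in>V. a x z * a x y)"
    by (intro sum.cong refl sum.swap)
  also have "\<dots> = C"
    unfolding C_def by (intro sum.cong refl) (metis a_sym)
  finally show "(\<Sum>x\<in>V. \<Sum>z\<in>V. \<Sum>y\<in>V. a x z * a x y) = C" .
qed

private lemma T_perm: "(\<Sum>x\<in>V. \<Sum>z\<in>V. \<Sum>y\<in>V. a x z * a y z * a x y) = T"
  unfolding T_def by (intro sum.cong refl sum.swap)

private lemma D_eq: "(\<Sum>x\<in>V. \<Sum>z\<in>V. \<Sum>y\<in>V. a x z) = int (card V) * degree_sum V h"
  by (simp add: degree_sum_def a_def sum_distrib_left mult.commute)

text \<open>Inclusion-exclusion for a vertex y that sees both ends of the adjacent pair x, z or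
  neither. This is the exact slack of the bound 2Q <= (n-2)D.\<close>

private lemma non_separating_count:
  "(\<Sum>x\<in>V. \<Sum>z\<in>V. \<Sum>y\<in>V. of_bool (h x z \<and> (h y z \<longleftrightarrow> h x y))) =
     int (card V) * degree_sum V h - 2 * C + 2 * T"
proof -
  \<comment> \<open>The triangle term is repeated instead of doubled so that the sum splits
    literally into the left-hand sides of \<open>C_perm\<close>, \<open>D_eq\<close> and
    \<open>T_perm\<close>.\<close>
  have "of_bool (h x z \<and> (h y z \<longleftrightarrow> h x y)) =
      a x z - a x z * a y z - a x z * a x y + a x z * a y z * a x y + a x z * a y z * a x y" for x y z
    by (auto simp: a_def)
  then show ?thesis
    by (simp only: sum_subtractf sum.distrib C_perm D_eq T_perm)
qed

private lemma common_neighbours_bound: "2 * C - T \<le> int (card V) * degree_sum V h"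
proof -
  have "of_bool (h x z \<and> \<not> h y z \<and> \<not> h x y) =
      a x z - a x z * a y z - a x z * a x y + a x z * a y z * a x y" for x y z
    by (auto simp: a_def)
  then have "(\<Sum>x\<in>V. \<Sum>z\<in>V. \<Sum>y\<in>V. of_bool (h x z \<and> \<not> h y z \<and> \<not> h x y)) =
      int (card V) * degree_sum V h - 2 * C + T"
    by (simp only: sum_subtractf sum.distrib C_perm D_eq T_perm)
  moreover have "(\<Sum>x\<in>V. \<Sum>z\<in>V. \<Sum>y\<in>V. of_bool (h x z \<and> \<not> h y z \<and> \<not> h x y)) \<ge> (0::int)"
    by (intro sum_nonneg) simp
  ultimately show ?thesis by linarith
qed

private lemma degree_squares_bound:
  "int (card V) * degree_sum V h \<le> C + int (card V) * int (balanced_cut (card V))"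
proof -
  let ?d = "\<lambda>x. \<Sum>y\<in>V. a x y"
  have "C = (\<Sum>x\<in>V. ?d x * ?d x)"
    by (simp add: C_perm(2)[symmetric] sum_product)
  moreover have "(\<Sum>x\<in>V. int (card V) * ?d x) \<le>
      (\<Sum>x\<in>V. ?d x * ?d x + int (balanced_cut (card V)))"
    by (intro sum_mono mult_le_square_plus_balanced_cut)
  ultimately show ?thesis
    by (simp add: sum.distrib degree_sum_def a_def sum_distrib_left)
qed

lemma card_cherries_le:
  assumes "2 \<le> card V"
  shows "int (card (cherries V h)) \<le>
    int (card V - 2) * int (balanced_cut (card V))"
  and card_cherries_extremal_degree_sum:
    "\<lbrakk>int (card (cherries V h)) = int (card V - 2) * int (balanced_cut (card V)); 2 < card V\<rbrakk>
      \<Longrightarrow> degree_sum V h = 2 * int (balanced_cut (card V))"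
  and card_cherries_extremal_separating:
    "\<lbrakk>int (card (cherries V h)) = int (card V - 2) * int (balanced_cut (card V)); 2 < card V;
      x \<in> V; y \<in> V; z \<in> V; h x z\<rbrakk>
      \<Longrightarrow> h y z \<longleftrightarrow> \<not> h x y"
proof -
  let ?n = "int (card V)" and ?D = "degree_sum V h" and ?Q = "int (card (cherries V h))"
    and ?m = "int (card V - 2)" and ?M = "int (balanced_cut (card V))"
  \<comment> \<open>\<open>S\<close> is the defect: the number of vertices failing to separate the
    ends of an adjacent pair, summed over all ordered adjacent pairs.\<close>
  define S where "S = (\<Sum>x\<in>V. \<Sum>z\<in>V. \<Sum>y\<in>V. of_bool (h x z \<and> (h y z \<longleftrightarrow> h x y)) :: int)"
  have S0: "0 \<le> S" unfolding S_def by (intro sum_nonneg) simp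
  have m: "?m = ?n - 2" using assms by simp
  have m0: "0 \<le> ?m" by simp
  have low: "2 * ?Q = ?m * ?D - S"
    unfolding S_def non_separating_count card_cherries m by (simp add: algebra_simps)
  have high: "?Q \<le> ?n * ?M - ?D"
    using common_neighbours_bound degree_squares_bound card_cherries by linarith
  \<comment> \<open>Adding \<open>low\<close> to \<open>?m\<close> times \<open>high\<close> cancels
    the degree sum and leaves \<open>- S\<close>. Hence equality in the final bound forces S = 0,
    from which both extremal claims follow.\<close>
  have "?m * ?Q \<le> ?m * (?n * ?M - ?D)" by (rule mult_left_mono[OF high m0])
  moreover have "?n * ?Q = ?m * ?Q + 2 * ?Q" unfolding m by (simp add: algebra_simps)
  ultimately have *: "?n * ?Q \<le> ?n * (?m * ?M) - S"
    using low by (simp add: algebra_simps)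
  then have "?n * ?Q \<le> ?n * (?m * ?M)" using S0 by linarith
  then show "?Q \<le> ?m * ?M" by (rule mult_left_le_imp_le) (use assms in simp)
  assume eq: "?Q = ?m * ?M" and n: "2 < card V"
  have S: "S = 0" using * S0 eq by simp
  have "?m * (2 * ?M) = ?m * ?D" using low S eq by simp
  \<comment> \<open>Cancelling \<open>?m\<close> is where \<open>2 < card V\<close> enters: on two
    vertices \<open>?m\<close> is 0 and the equation says nothing about the degree sum.\<close>
  then show "?D = 2 * ?M" using n by (metis mult_cancel_left of_nat_eq_0_iff zero_less_diff less_not_refl)
  assume xyz: "x \<in> V" "y \<in> V" "z \<in> V" "h x z"
  have "\<forall>x\<in>V. \<forall>z\<in>V. \<forall>y\<in>V. \<not> (h x z \<and> (h y z \<longleftrightarrow> h x y))"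
    using S unfolding S_def by (simp add: sum_nonneg_eq_0_iff fin sum_nonneg) blast
  then show "h y z \<longleftrightarrow> \<not> h x y" using xyz by blast
qed

text \<open>Fix one edge pq. Every vertex is adjacent to exactly one of p and q, and this splits V
  into the two sides. The degree sum then fixes the product of the side sizes.\<close>

lemma extremal_cherries_bipartite:
  assumes n: "2 < card V"
    and eq: "int (card (cherries V h)) =
      int (card V - 2) * int (balanced_cut (card V))"
  obtains A where "A \<subseteq> V" "card A = card V div 2"
    "\<And>x y. x \<in> V \<Longrightarrow> y \<in> V \<Longrightarrow> h x y \<longleftrightarrow> (x \<in> A \<longleftrightarrow> y \<notin> A)"
proof -
  have n2: "2 \<le> card V" using n by simp
  note sep = card_cherries_extremal_separating[OF n2 eq n]
  note D = card_cherries_extremal_degree_sum[OF n2 eq n]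
  have "degree_sum V h \<noteq> 0" unfolding D using n by simp
  moreover have "degree_sum V h = 0" if "\<forall>p\<in>V. \<forall>q\<in>V. \<not> h p q"
    using that by (simp add: degree_sum_def)
  ultimately obtain p q where pq: "p \<in> V" "q \<in> V" "h p q" by blast
  define A where "A = {x \<in> V. h x p}"
  have bip: "h x y \<longleftrightarrow> (x \<in> A \<longleftrightarrow> y \<notin> A)" if "x \<in> V" "y \<in> V" for x y
  proof -
    have A: "v \<in> A \<longleftrightarrow> h v p" "v \<in> A \<longleftrightarrow> \<not> h v q" if "v \<in> V" for v
      using sep[of p v q] pq sym that unfolding A_def by blast+
    show ?thesis
    \<comment> \<open>Two vertices on one side have a common neighbour, p or q, which would fail to
      separate them if they were adjacent. In the mixed cases the vertex outside A must separate the
      edge from the vertex in A to p.\<close>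
    proof (cases "x \<in> A"; cases "y \<in> A")
      assume "x \<in> A" "y \<in> A"
      then show ?thesis using A that sep[of x p y] pq(1) sym by blast
    next
      assume "x \<in> A" "y \<notin> A"
      then show ?thesis using A that sep[of x y p] pq(1) by blast
    next
      assume "x \<notin> A" "y \<in> A"
      then show ?thesis using A that sep[of y x p] pq(1) sym by blast
    next
      assume "x \<notin> A" "y \<notin> A"
      then show ?thesis using A that sep[of x q y] pq(2) sym by blast
    qed
  qed
  have AV: "A \<subseteq> V" unfolding A_def by auto
  have finA: "finite A" using AV fin finite_subset by blast
  have row: "(\<Sum>y\<in>V. of_bool (h x y)) = (if x \<in> A then int (card (V - A)) else int (card A))"
    if "x \<in> V" for x
  proof -
    have "(\<Sum>y\<in>V. of_bool (h x y)) = int (card {y \<in> V. h x y})"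
      using fin by (simp add: of_bool_def sum.If_cases Int_def)
    moreover have "{y \<in> V. h x y} = (if x \<in> A then V - A else A)"
      using bip that AV by auto
    ultimately show ?thesis by simp
  qed
  have "degree_sum V h = (\<Sum>x\<in>V. if x \<in> A then int (card (V - A)) else int (card A))"
    unfolding degree_sum_def by (intro sum.cong refl row)
  also have "\<dots> = 2 * int (card A * card (V - A))"
    using fin AV by (simp add: sum.If_cases Int_absorb1 Diff_eq[symmetric])
  finally have "card A * card (V - A) = balanced_cut (card V)"
    unfolding D by presburger
  moreover have "card A + card (V - A) = card V"
    using fin AV finA by (simp add: card_Diff_subset card_mono)
  ultimately have "card A = card V div 2 \<or> card (V - A) = card V div 2"
    by (intro factors_of_balanced_cut) auto
  \<comment> \<open>Either side may be the one of size \<open>card V div 2\<close>; the adjacency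
    rule is unchanged under complementing A.\<close>
  then show thesis
  proof
    assume "card A = card V div 2"
    with AV bip show thesis by (intro that[of A]) auto
  next
    assume "card (V - A) = card V div 2"
    with AV bip show thesis by (intro that[of "V - A"]) auto
  qed
qed

end

section \<open>Edges as ordered triples, and copies of R3\<close>

definition arrows :: "'a dhgraph \<Rightarrow> ('a \<times> 'a \<times> 'a) set" where
  "arrows G = {(x, y, z). arrow x y z \<in> edges G}"

definition head_pair :: "'a dhgraph \<Rightarrow> 'a \<Rightarrow> 'a \<Rightarrow> bool" where
  "head_pair G x y \<longleftrightarrow> (\<exists>z. arrow x z y \<in> edges G \<or> arrow y z x \<in> edges G)"

lemma arrow_commute: "arrow x y z = arrow y x z"
  by (auto simp: arrow_def)

lemma card_3_distinct:
  assumes "card {x, y, z} = 3"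
  shows "x \<noteq> y \<and> x \<noteq> z \<and> y \<noteq> z"
  using assms by (auto simp: card_insert_if split: if_splits)

lemma dhgraph_edgeD:
  assumes "dhgraph G" "(S, c) \<in> edges G"
  shows "S \<subseteq> verts G \<and> card S = 3 \<and> c \<in> S"
  using assms unfolding dhgraph_def by auto

lemma arrow_in_edges:
  assumes "dhgraph G" "arrow x y z \<in> edges G"
  shows "x \<in> verts G" "y \<in> verts G" "z \<in> verts G" "x \<noteq> y" "x \<noteq> z" "y \<noteq> z"
proof -
  have S: "{x, y, z} \<subseteq> verts G" "card {x, y, z} = 3"
    using dhgraph_edgeD[OF assms(1) assms(2)[unfolded arrow_def]] by simp_all
  show "x \<in> verts G" "y \<in> verts G" "z \<in> verts G" using S(1) by simp_all
  show "x \<noteq> y" "x \<noteq> z" "y \<noteq> z" using card_3_distinct[OF S(2)] by blast+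
qed

lemma edge_arrow:
  assumes "dhgraph G" "e \<in> edges G"
  obtains x y z where "e = arrow x y z"
proof -
  obtain S c where e: "e = (S, c)" by (cases e)
  then have "card S = 3" "c \<in> S" using assms unfolding dhgraph_def by auto
  then have "card (S - {c}) = 2" by simp
  then obtain x y where "S - {c} = {x, y}" by (auto simp: card_2_iff)
  then have "S = {x, y, c}" using \<open>c \<in> S\<close> by blast
  then show thesis using that e by (auto simp: arrow_def)
qed

lemma finite_edges:
  assumes "dhgraph G"
  shows "finite (edges G)"
proof (rule finite_subset)
  show "edges G \<subseteq> Pow (verts G) \<times> verts G" using assms unfolding dhgraph_def by auto
  show "finite (Pow (verts G) \<times> verts G)" using assms unfolding dhgraph_def by simp
qed

text \<open>Distinctness matters: \<open>arrow x x z\<close> and \<open>arrow x z z\<close> coincide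
  as pairs of a set and a head.\<close>

lemma arrow_eq_iff:
  assumes "x \<noteq> y" "x \<noteq> z" "y \<noteq> z"
  shows "arrow x' y' z' = arrow x y z \<longleftrightarrow> z' = z \<and> (x' = x \<and> y' = y \<or> x' = y \<and> y' = x)"
proof
  assume eq: "arrow x' y' z' = arrow x y z"
  then have "z' = z" "x \<in> {x', y', z'}" "y \<in> {x', y', z'}" unfolding arrow_def by auto
  then show "z' = z \<and> (x' = x \<and> y' = y \<or> x' = y \<and> y' = x)" using assms by auto
qed (auto simp: arrow_def)

text \<open>The fibre of \<open>arrow\<close> over an edge consists of the two orders of its
  tail.\<close>

lemma card_arrows:
  assumes "dhgraph G"
  shows "card (arrows G) = 2 * card (edges G)"
proof -
  define fibre where "fibre e = {(x, y, z). arrow x y z = e}" for e :: "'a set \<times> 'a"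
  have fibre: "card (fibre e) = 2" if e: "e \<in> edges G" for e
  proof -
    obtain x y z where e': "e = arrow x y z" using edge_arrow[OF assms e] .
    then have d: "x \<noteq> y" "x \<noteq> z" "y \<noteq> z" using arrow_in_edges[OF assms] e by metis+
    have "fibre e = {(x, y, z), (y, x, z)}"
      unfolding fibre_def e' arrow_eq_iff[OF d] by auto
    then show ?thesis using d by simp
  qed
  have "arrows G = (\<Union>e\<in>edges G. fibre e)" unfolding arrows_def fibre_def by auto
  also have "card \<dots> = (\<Sum>e\<in>edges G. card (fibre e))"
  proof (rule card_UN_disjoint)
    show "finite (edges G)" by (rule finite_edges[OF assms])
    show "\<forall>e\<in>edges G. finite (fibre e)"
      using fibre by (metis card.infinite zero_neq_numeral)
    show "\<forall>e\<in>edges G. \<forall>f\<in>edges G. e \<noteq> f \<longrightarrow> fibre e \<inter> fibre f = {}"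
      unfolding fibre_def by auto
  qed
  also have "\<dots> = 2 * card (edges G)" using fibre by simp
  finally show ?thesis .
qed

lemma dh_free_R3_iff:
  "dh_free R3 G \<longleftrightarrow> \<not> (\<exists>a b c d. distinct [a, b, c, d] \<and> {a, b, c, d} \<subseteq> verts G \<and>
     arrow a b c \<in> edges G \<and> arrow b c d \<in> edges G)"
  (is "_ \<longleftrightarrow> \<not> ?copy")
proof -
  have "?copy" if \<phi>: "dh_hom \<phi> R3 G" "inj_on \<phi> (verts R3)" for \<phi>
  proof -
    have "distinct (map \<phi> [0, 1, 2, 3])"
      unfolding distinct_map using \<phi>(2) by (simp add: R3_def)
    then have "distinct [\<phi> 0, \<phi> 1, \<phi> 2, \<phi> 3]" by (simp only: list.map)
    moreover have "{\<phi> 0, \<phi> 1, \<phi> 2, \<phi> 3} \<subseteq> verts G"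
      using \<phi>(1) unfolding R3_def dh_hom_def by simp
    moreover have "arrow 0 1 2 \<in> edges R3" "arrow 1 2 3 \<in> edges R3" by (simp_all add: R3_def)
    then have "arrow (\<phi> 0) (\<phi> 1) (\<phi> 2) \<in> edges G" "arrow (\<phi> 1) (\<phi> 2) (\<phi> 3) \<in> edges G"
      using \<phi>(1) unfolding dh_hom_def by blast+
    ultimately show ?thesis by blast
  qed
  moreover have "\<not> dh_free R3 G" if copy: "?copy"
  proof -
    obtain a b c d where abcd: "distinct [a, b, c, d]" "{a, b, c, d} \<subseteq> verts G"
      "arrow a b c \<in> edges G" "arrow b c d \<in> edges G" using copy by blast
    define \<phi> where "\<phi> i = (if i = 0 then a else if i = 1 then b else if i = 2 then c else d)"
      for i :: nat
    have "arrow (\<phi> i) (\<phi> j) (\<phi> k) \<in> edges G" if "arrow i j k \<in> edges R3" for i j k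
    proof -
      \<comment> \<open>A homomorphism is tested on every ordered triple, so each of the two edges
        has to be decoded with both orders of its tail.\<close>
      have "arrow i j k = arrow 0 1 2 \<or> arrow i j k = arrow 1 2 3"
        using that by (simp add: R3_def)
      then have "k = 2 \<and> (i = 0 \<and> j = 1 \<or> i = 1 \<and> j = 0) \<or>
          k = 3 \<and> (i = 1 \<and> j = 2 \<or> i = 2 \<and> j = 1)"
        by (simp add: arrow_eq_iff)
      then show ?thesis
        using abcd(3,4) arrow_commute[of b a c] arrow_commute[of c b d] by (auto simp: \<phi>_def)
    qed
    moreover have "\<phi> ` verts R3 \<subseteq> verts G" using abcd(2) by (auto simp: R3_def \<phi>_def)
    moreover have "inj_on \<phi> (verts R3)" using abcd(1) by (auto simp: R3_def \<phi>_def inj_on_def)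
    ultimately show ?thesis unfolding dh_free_def dh_hom_def by blast
  qed
  ultimately show ?thesis unfolding dh_free_def by blast
qed

section \<open>From R3-free oriented graphs to cherries of head pairs\<close>

lemma head_pair_sym: "head_pair G x y \<Longrightarrow> head_pair G y x"
  unfolding head_pair_def by auto

lemma head_pair_irrefl: "dhgraph G \<Longrightarrow> \<not> head_pair G x x"
  unfolding head_pair_def by (auto dest: arrow_in_edges(5))

lemma tail_pair_not_head_pair:
  assumes G: "dhgraph G" "oriented G" "dh_free R3 G" and xyz: "arrow x y z \<in> edges G"
  shows "\<not> head_pair G x y"
proof -
  \<comment> \<open>If w = r, the set {p, q, r} carries two heads, against orientation. Otherwise wp
    -> q and pq -> r form a copy of R3.\<close>
  have no: False if "arrow p q r \<in> edges G" "arrow p w q \<in> edges G" for p q r w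
  proof (cases "w = r")
    case True
    then have "{p, w, q} = {p, q, r}" by auto
    then have "q = r" using that G(2) unfolding oriented_def arrow_def by metis
    then show False using arrow_in_edges[OF G(1) that(1)] by simp
  next
    case False
    note arrow_in_edges[OF G(1) that(1)] arrow_in_edges[OF G(1) that(2)]
    moreover have "arrow w p q \<in> edges G" using that(2) arrow_commute by metis
    ultimately have "\<exists>a b c d. distinct [a, b, c, d] \<and> {a, b, c, d} \<subseteq> verts G \<and>
        arrow a b c \<in> edges G \<and> arrow b c d \<in> edges G"
      using that False by (intro exI[of _ w] exI[of _ p] exI[of _ q] exI[of _ r]) auto
    then show False using G(3) unfolding dh_free_R3_iff by blast
  qed
  show ?thesis
    using no[of x y z] no[of y x z] xyz arrow_commute[of x y z] unfolding head_pair_def by auto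
qed

lemma arrows_subset_cherries:
  assumes G: "dhgraph G" "oriented G" "dh_free R3 G"
  shows "arrows G \<subseteq> cherries (verts G) (head_pair G)"
proof -
  have "(x, y, z) \<in> cherries (verts G) (head_pair G)" if xyz: "arrow x y z \<in> edges G" for x y z
  proof -
    have "head_pair G x z" "head_pair G y z"
      using xyz arrow_commute unfolding head_pair_def by metis+
    then show ?thesis
      using arrow_in_edges[OF G(1) xyz] tail_pair_not_head_pair[OF G xyz]
      unfolding cherries_def by simp
  qed
  then show ?thesis unfolding arrows_def by auto
qed

lemma finite_cherries: "finite V \<Longrightarrow> finite (cherries V h)"
  unfolding cherries_def by (rule finite_subset[of _ "V \<times> V \<times> V"]) auto

lemma edges_empty_if_small:
  assumes "dhgraph G" "card (verts G) \<le> 2"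
  shows "edges G = {}"
proof -
  have False if "(S, c) \<in> edges G" for S c
  proof -
    have "S \<subseteq> verts G" "card S = 3" "finite (verts G)"
      using assms(1) that unfolding dhgraph_def by auto
    then show False using card_mono[of "verts G" S] assms(2) by simp
  qed
  then show ?thesis by auto
qed

lemma card_head_pair_cherries_le:
  assumes "dhgraph G" "2 \<le> card (verts G)"
  shows "card (cherries (verts G) (head_pair G)) \<le> (card (verts G) - 2) * balanced_cut (card (verts G))"
proof -
  have "int (card (cherries (verts G) (head_pair G))) \<le>
      int (card (verts G) - 2) * int (balanced_cut (card (verts G)))"
  proof (rule card_cherries_le)
    show "finite (verts G)" using assms(1) unfolding dhgraph_def by simp
  qed (erule head_pair_sym, rule head_pair_irrefl[OF assms(1)], rule assms(2))
  then show ?thesis by (simp only: of_nat_mult[symmetric] of_nat_le_iff)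
qed

lemma card_edges_le:
  assumes "free_oriented n R3 G"
  shows "2 * card (edges G) \<le> (n - 2) * balanced_cut n"
proof -
  have G: "dhgraph G" "oriented G" "dh_free R3 G" and n: "card (verts G) = n"
    using assms unfolding free_oriented_def by auto
  have fin: "finite (verts G)" using G(1) unfolding dhgraph_def by simp
  show ?thesis
  proof (cases "2 \<le> n")
    case True
    have "2 * card (edges G) \<le> card (cherries (verts G) (head_pair G))"
      unfolding card_arrows[OF G(1), symmetric]
      by (intro card_mono finite_cherries fin arrows_subset_cherries G)
    also have "\<dots> \<le> (n - 2) * balanced_cut n"
      using card_head_pair_cherries_le[OF G(1)] True unfolding n by simp
    finally show ?thesis .
  next
    \<comment> \<open>Here the truncated difference \<open>n - 2\<close> is 0, matching the absence
      of edges.\<close>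
    case False
    then show ?thesis using edges_empty_if_small[OF G(1)] n by simp
  qed
qed

text \<open>For \<open>n \<le> 2\<close> there are no edges, and any \<open>A\<close> of the right size works.\<close>

lemma extremal_structure:
  assumes "free_oriented n R3 G" and eq: "2 * card (edges G) = (n - 2) * balanced_cut n"
  obtains A where "A \<subseteq> verts G" "card A = n div 2"
    "\<And>x y z. \<lbrakk>x \<in> verts G; y \<in> verts G; z \<in> verts G\<rbrakk> \<Longrightarrow>
      arrow x y z \<in> edges G \<longleftrightarrow> x \<noteq> y \<and> (x \<in> A \<longleftrightarrow> y \<in> A) \<and> (x \<in> A \<longleftrightarrow> z \<notin> A)"
proof -
  have G: "dhgraph G" "oriented G" "dh_free R3 G" and n: "card (verts G) = n"
    using assms unfolding free_oriented_def by auto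
  have fin: "finite (verts G)" using G(1) unfolding dhgraph_def by simp
  show thesis
  proof (cases "2 < n")
    case True
    let ?h = "head_pair G"
    have sub: "arrows G \<subseteq> cherries (verts G) ?h" by (rule arrows_subset_cherries[OF G])
    have "card (cherries (verts G) ?h) \<le> (n - 2) * balanced_cut n"
      using card_head_pair_cherries_le[OF G(1)] True unfolding n by simp
    moreover have "card (arrows G) \<le> card (cherries (verts G) ?h)"
      by (intro card_mono finite_cherries fin sub)
    \<comment> \<open>The cherries are squeezed between \<open>card (arrows G)\<close> and the upper
      bound, which agree by \<open>eq\<close>; so every cherry comes from an edge.\<close>
    ultimately have card_eq: "card (cherries (verts G) ?h) = (n - 2) * balanced_cut n"
      and "card (arrows G) = card (cherries (verts G) ?h)"
      using card_arrows[OF G(1)] eq by auto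
    then have arrows: "arrows G = cherries (verts G) ?h"
      by (intro card_subset_eq finite_cherries fin sub)
    have "int (card (cherries (verts G) ?h)) =
        int (card (verts G) - 2) * int (balanced_cut (card (verts G)))"
      unfolding n card_eq by (rule of_nat_mult)
    then obtain A where A: "A \<subseteq> verts G" "card A = n div 2"
      "\<And>x y. x \<in> verts G \<Longrightarrow> y \<in> verts G \<Longrightarrow> ?h x y \<longleftrightarrow> (x \<in> A \<longleftrightarrow> y \<notin> A)"
      using extremal_cherries_bipartite[where V = "verts G" and h = ?h, OF fin head_pair_sym
          head_pair_irrefl[OF G(1)]] True unfolding n by metis
    show thesis
    proof (rule that[OF A(1,2)])
      fix x y z assume V: "x \<in> verts G" "y \<in> verts G" "z \<in> verts G"
      have "arrow x y z \<in> edges G \<longleftrightarrow> (x, y, z) \<in> cherries (verts G) ?h"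
        unfolding arrows[symmetric] arrows_def by simp
      then show "arrow x y z \<in> edges G \<longleftrightarrow> x \<noteq> y \<and> (x \<in> A \<longleftrightarrow> y \<in> A) \<and> (x \<in> A \<longleftrightarrow> z \<notin> A)"
        using V A(3) unfolding cherries_def by auto
    qed
  next
    case False
    obtain A where A: "A \<subseteq> verts G" "card A = n div 2"
      using obtain_subset_with_card_n[of "n div 2" "verts G"] n by auto
    have none: "\<not> (x \<noteq> y \<and> (x \<in> A \<longleftrightarrow> y \<in> A) \<and> (x \<in> A \<longleftrightarrow> z \<notin> A))"
      if "x \<in> verts G" "y \<in> verts G" "z \<in> verts G" for x y z
    proof
      assume xyz: "x \<noteq> y \<and> (x \<in> A \<longleftrightarrow> y \<in> A) \<and> (x \<in> A \<longleftrightarrow> z \<notin> A)"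
      then have "card {x, y, z} = 3" by (auto simp: card_insert_if)
      moreover have "{x, y, z} \<subseteq> verts G" using that by simp
      ultimately show False using card_mono[OF fin, of "{x, y, z}"] n False by simp
    qed
    have "edges G = {}" using edges_empty_if_small[OF G(1)] n False by simp
    then show thesis by (intro that[OF A]) (use none in auto)
  qed
qed

section \<open>The extremal construction\<close>

text \<open>For disjoint A and B, each triple meeting both sides is headed by the vertex that is
  alone on its side.\<close>

definition bipartite_dhgraph :: "'a set \<Rightarrow> 'a set \<Rightarrow> 'a dhgraph" where
  "bipartite_dhgraph A B = \<lparr>verts = A \<union> B,
     edges = {arrow x y z | x y z. x \<noteq> y \<and> (x \<in> A \<and> y \<in> A \<and> z \<in> B \<or> x \<in> B \<and> y \<in> B \<and> z \<in> A)}\<rparr>"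

context
  fixes A B :: "'a set"
  assumes fin: "finite A" "finite B" and disj: "A \<inter> B = {}"
begin

lemma arrow_in_bipartite_iff:
  "arrow x y z \<in> edges (bipartite_dhgraph A B) \<longleftrightarrow>
     x \<noteq> y \<and> (x \<in> A \<and> y \<in> A \<and> z \<in> B \<or> x \<in> B \<and> y \<in> B \<and> z \<in> A)"
  (is "_ \<longleftrightarrow> ?P x y z")
proof
  assume "arrow x y z \<in> edges (bipartite_dhgraph A B)"
  then obtain x' y' z' where eq: "arrow x y z = arrow x' y' z'" and P: "?P x' y' z'"
    unfolding bipartite_dhgraph_def by auto
  have "x' \<noteq> y'" "x' \<noteq> z'" "y' \<noteq> z'" using P disj by auto
  from eq[unfolded arrow_eq_iff[OF this]] show "?P x y z" using P by auto
qed (auto simp: bipartite_dhgraph_def)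

lemma dhgraph_bipartite: "dhgraph (bipartite_dhgraph A B)"
proof -
  have "card {x, y, z} = 3" if "x \<noteq> y" "x \<in> A \<and> y \<in> A \<and> z \<in> B \<or> x \<in> B \<and> y \<in> B \<and> z \<in> A" for x y z
    using that disj by (auto simp: card_insert_if)
  then show ?thesis
    using fin unfolding dhgraph_def bipartite_dhgraph_def arrow_def by auto
qed

lemma oriented_bipartite: "oriented (bipartite_dhgraph A B)"
  unfolding oriented_def
proof (intro allI impI, elim conjE)
  fix S c d
  let ?E = "edges (bipartite_dhgraph A B)"
  assume "(S, c) \<in> ?E" "(S, d) \<in> ?E"
  moreover obtain x y z where "(S, c) = arrow x y z"
    using edge_arrow[OF dhgraph_bipartite calculation(1)] .
  moreover obtain x' y' z' where "(S, d) = arrow x' y' z'"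
    using edge_arrow[OF dhgraph_bipartite calculation(2)] .
  ultimately have E: "arrow x y c \<in> ?E" "arrow x' y' d \<in> ?E" and eq: "{x', y', d} = {x, y, c}"
    unfolding arrow_def by auto
  note E1 = E(1)[unfolded arrow_in_bipartite_iff] and E2 = E(2)[unfolded arrow_in_bipartite_iff]
  have only_head: "v = c" if "v \<in> {x', y', d}" "v \<in> A \<longleftrightarrow> c \<in> A" for v
  proof -
    have "v \<in> {x, y, c}" using that(1) unfolding eq .
    moreover have "x \<in> A \<longleftrightarrow> c \<notin> A" "y \<in> A \<longleftrightarrow> c \<notin> A" using E1 disj by auto
    ultimately show ?thesis using that(2) by auto
  qed
  \<comment> \<open>If d were on the side opposite to c, then x' and y' would both lie on the side
    of c and hence both equal c, although they are distinct.\<close>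
  have "x' \<noteq> y'" "x' \<in> A \<longleftrightarrow> d \<notin> A" "y' \<in> A \<longleftrightarrow> d \<notin> A" using E2 disj by auto
  then show "c = d" using only_head[of x'] only_head[of y'] only_head[of d] by auto
qed

text \<open>In a copy, ab -> c puts b and c on opposite sides, while bc -> d needs them on the same
  side.\<close>

lemma dh_free_R3_bipartite: "dh_free R3 (bipartite_dhgraph A B)"
  unfolding dh_free_R3_iff arrow_in_bipartite_iff using disj by blast

lemma card_edges_bipartite:
  "2 * card (edges (bipartite_dhgraph A B)) = (card A + card B - 2) * (card A * card B)"
proof -
  have off_diag: "card {(x, y, z). x \<in> S \<and> y \<in> S \<and> z \<in> R \<and> x \<noteq> y} = card S * (card S - 1) * card R"
    if "finite S" "finite R" for S R :: "'a set"
  proof -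
    have "{(x, y, z). x \<in> S \<and> y \<in> S \<and> z \<in> R \<and> x \<noteq> y} = (SIGMA x:S. (S - {x}) \<times> R)" by auto
    then show ?thesis using that by (simp add: card_cartesian_product)
  qed
  let ?X = "{(x, y, z). x \<in> A \<and> y \<in> A \<and> z \<in> B \<and> x \<noteq> y}"
  let ?Y = "{(x, y, z). x \<in> B \<and> y \<in> B \<and> z \<in> A \<and> x \<noteq> y}"
  have "arrows (bipartite_dhgraph A B) = ?X \<union> ?Y"
    unfolding arrows_def arrow_in_bipartite_iff by auto
  moreover have "finite ?X" "finite ?Y"
    using fin by (auto intro: finite_subset[of _ "A \<times> A \<times> B"] finite_subset[of _ "B \<times> B \<times> A"])
  moreover have "?X \<inter> ?Y = {}" using disj by auto
  ultimately have "2 * card (edges (bipartite_dhgraph A B)) =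
      card A * (card A - 1) * card B + card B * (card B - 1) * card A"
    unfolding card_arrows[OF dhgraph_bipartite, symmetric]
    by (simp only: card_Un_disjoint off_diag[OF fin] off_diag[OF fin(2,1)])
  also have "\<dots> = (card A + card B - 2) * (card A * card B)"
    \<comment> \<open>Splitting off zero resolves the truncated subtractions; an empty side makes
      both sides of the equation 0.\<close>
    by (cases "card A"; cases "card B") (auto simp: algebra_simps)
  finally show ?thesis .
qed

end

section \<open>Uniqueness and the extremal number\<close>

text \<open>Edges depend only on equality and on the side of each vertex, so any bijection of the
  vertices that respects the sides is an isomorphism; one is glued from bijections A to B and
  complement to complement.\<close>

lemma dh_iso_if_same_structure:
  assumes G: "finite (verts G)" "A \<subseteq> verts G"
      "\<And>x y z. \<lbrakk>x \<in> verts G; y \<in> verts G; z \<in> verts G\<rbrakk> \<Longrightarrow>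
        arrow x y z \<in> edges G \<longleftrightarrow> x \<noteq> y \<and> (x \<in> A \<longleftrightarrow> y \<in> A) \<and> (x \<in> A \<longleftrightarrow> z \<notin> A)"
    and H: "finite (verts H)" "B \<subseteq> verts H"
      "\<And>x y z. \<lbrakk>x \<in> verts H; y \<in> verts H; z \<in> verts H\<rbrakk> \<Longrightarrow>
        arrow x y z \<in> edges H \<longleftrightarrow> x \<noteq> y \<and> (x \<in> B \<longleftrightarrow> y \<in> B) \<and> (x \<in> B \<longleftrightarrow> z \<notin> B)"
    and "card (verts G) = card (verts H)" "card A = card B"
  shows "dh_iso G H"
proof -
  have fin: "finite A" "finite B" using G(1,2) H(1,2) finite_subset by blast+
  obtain f where f: "bij_betw f A B"
    using finite_same_card_bij[OF fin assms(8)] by blast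
  have "card (verts G - A) = card (verts H - B)"
    using G(2) H(2) fin assms(7,8) by (simp add: card_Diff_subset)
  then obtain g where g: "bij_betw g (verts G - A) (verts H - B)"
    using finite_same_card_bij[of "verts G - A" "verts H - B"] G(1) H(1) by blast
  define \<phi> where "\<phi> x = (if x \<in> A then f x else g x)" for x
  have "bij_betw \<phi> A B" using f by (subst bij_betw_cong[of A \<phi> f]) (auto simp: \<phi>_def)
  moreover have "bij_betw \<phi> (verts G - A) (verts H - B)"
    using g by (subst bij_betw_cong[of _ \<phi> g]) (auto simp: \<phi>_def)
  ultimately have "bij_betw \<phi> (A \<union> (verts G - A)) (B \<union> (verts H - B))"
    by (rule bij_betw_combine) auto
  then have bij: "bij_betw \<phi> (verts G) (verts H)" using G(2) H(2) by (simp add: Un_absorb1)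
  have mem: "\<phi> x \<in> verts H" "\<phi> x \<in> B \<longleftrightarrow> x \<in> A" if "x \<in> verts G" for x
    using that f g bij by (auto simp: \<phi>_def bij_betw_def)
  have inj: "\<phi> x = \<phi> y \<longleftrightarrow> x = y" if "x \<in> verts G" "y \<in> verts G" for x y
    using bij that unfolding bij_betw_def inj_on_def by blast
  show ?thesis
    unfolding dh_iso_def using bij by (intro exI[of _ \<phi>]) (simp add: G(3) H(3) mem inj)
qed

lemma extremal_graph_exists:
  obtains G :: "nat dhgraph"
  where "free_oriented n R3 G" "2 * card (edges G) = (n - 2) * balanced_cut n"
proof -
  let ?A = "{..<n div 2}" and ?B = "{n div 2..<n}"
  let ?G = "bipartite_dhgraph ?A ?B"
  have disj: "?A \<inter> ?B = {}" by auto
  have sz: "card ?A + card ?B = n" "card ?B = (n + 1) div 2" by simp_all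
  have "verts ?G = {..<n}" by (auto simp: bipartite_dhgraph_def)
  then have "free_oriented n R3 ?G"
    unfolding free_oriented_def
    using dhgraph_bipartite[OF _ _ disj] oriented_bipartite[OF _ _ disj]
      dh_free_R3_bipartite[OF _ _ disj]
    by simp
  moreover have "2 * card (edges ?G) = (n - 2) * balanced_cut n"
    using card_edges_bipartite[OF _ _ disj] sz by simp
  ultimately show thesis by (rule that)
qed

lemma two_ex_o_R3: "2 * ex_o n R3 = (n - 2) * balanced_cut n"
proof -
  let ?S = "{card (edges G) | G :: nat dhgraph. free_oriented n R3 G}"
  obtain G :: "nat dhgraph" where G: "free_oriented n R3 G"
    "2 * card (edges G) = (n - 2) * balanced_cut n" by (rule extremal_graph_exists)
  have le: "k \<le> card (edges G)" if "k \<in> ?S" for k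
    using that card_edges_le G(2) by fastforce
  \<comment> \<open>\<open>Max\<close> is determined only on finite sets; the bound by the number of
    edges of G supplies finiteness.\<close>
  then have "finite ?S" by (meson finite_nat_set_iff_bounded_le)
  then have "ex_o n R3 = card (edges G)"
    unfolding ex_o_def using le G(1) by (intro Max_eqI) auto
  then show ?thesis using G(2) by simp
qed

theorem theorem2:
  fixes n :: nat
  shows "real (ex_o n R3) =
           real_of_int \<lfloor>real n / 2\<rfloor> * real_of_int \<lceil>real n / 2\<rceil> * ((real n - 2) / 2) \<and>
         (\<exists>G :: nat dhgraph.
            free_oriented n R3 G \<and> card (edges G) = ex_o n R3 \<and>
            (\<forall>H :: 'a dhgraph.
               free_oriented n R3 H \<and> card (edges H) = ex_o n R3 \<longrightarrow> dh_iso G H))"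
proof
  have floor: "\<lfloor>real n / 2\<rfloor> = int (n div 2)" by (metis floor_divide_of_nat_eq of_nat_numeral)
  have ceiling: "\<lceil>real n / 2\<rceil> = int ((n + 1) div 2)"
    by (cases "even n") (auto elim!: evenE oddE simp: ceiling_eq_iff)
  have "2 * real (ex_o n R3) = real (n - 2) * real (balanced_cut n)"
    using two_ex_o_R3[of n] by (metis of_nat_mult of_nat_numeral)
  \<comment> \<open>For n < 2 the truncated and the real difference disagree, but then
    \<open>n div 2\<close> is 0 and both products vanish.\<close>
  moreover have "real (n - 2) * real (balanced_cut n) = (real n - 2) * real (balanced_cut n)"
  proof (cases "2 \<le> n")
    case False
    then have "n div 2 = 0" by simp
    then show ?thesis by simp
  qed (simp add: of_nat_diff)
  ultimately show "real (ex_o n R3) =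
      real_of_int \<lfloor>real n / 2\<rfloor> * real_of_int \<lceil>real n / 2\<rceil> * ((real n - 2) / 2)"
    unfolding floor ceiling by (simp add: algebra_simps)
next
  obtain G :: "nat dhgraph" where G: "free_oriented n R3 G"
    "2 * card (edges G) = (n - 2) * balanced_cut n" by (rule extremal_graph_exists)
  \<comment> \<open>The constructed graph is described by the same structure result as an arbitrary
    extremal H, so the two descriptions match literally, whatever the vertex type of H.\<close>
  obtain A where A: "A \<subseteq> verts G" "card A = n div 2"
    "\<And>x y z. \<lbrakk>x \<in> verts G; y \<in> verts G; z \<in> verts G\<rbrakk> \<Longrightarrow>
      arrow x y z \<in> edges G \<longleftrightarrow> x \<noteq> y \<and> (x \<in> A \<longleftrightarrow> y \<in> A) \<and> (x \<in> A \<longleftrightarrow> z \<notin> A)"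
    using extremal_structure[OF G] by blast
  have "dh_iso G H" if H: "free_oriented n R3 H" "card (edges H) = ex_o n R3" for H :: "'a dhgraph"
  proof -
    have "2 * card (edges H) = (n - 2) * balanced_cut n" using H(2) two_ex_o_R3 by simp
    from extremal_structure[OF H(1) this] obtain B where B: "B \<subseteq> verts H" "card B = n div 2"
      "\<And>x y z. \<lbrakk>x \<in> verts H; y \<in> verts H; z \<in> verts H\<rbrakk> \<Longrightarrow>
        arrow x y z \<in> edges H \<longleftrightarrow> x \<noteq> y \<and> (x \<in> B \<longleftrightarrow> y \<in> B) \<and> (x \<in> B \<longleftrightarrow> z \<notin> B)"
      by blast
    show ?thesis
      by (rule dh_iso_if_same_structure[OF _ A(1,3) _ B(1,3)])
        (use G(1) H(1) A(2) B(2) in \<open>auto simp: free_oriented_def dhgraph_def\<close>)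
  qed
  moreover have "card (edges G) = ex_o n R3" using G(2) two_ex_o_R3[of n] by simp
  ultimately show "\<exists>G :: nat dhgraph. free_oriented n R3 G \<and> card (edges G) = ex_o n R3 \<and>
      (\<forall>H :: 'a dhgraph. free_oriented n R3 H \<and> card (edges H) = ex_o n R3 \<longrightarrow> dh_iso G H)"
    using G(1) by blast
qed

end
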